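(* Let $(\Omega,\mathcal{B}_{\max},\mathbf{P})$ be a probability space, and let $\mathcal{B}_{\mathrm{reg}}\subseteq\mathcal{B}_{\max}$ be an algebra of events. Let $J$ be a finite set and let $\mathbf{i}_{\max}$ be a downset in $J$. For each $e\in\mathbf{i}_{\max}$ let $\mathcal{B}_e$ be a factor of $\mathcal{B}_{\max}$ such that: (Regularisability) each $\mathcal{B}_e$ is generated (as a $\sigma$-algebra) by countably many events from $\mathcal{B}_{\mathrm{reg}}$; (Nesting) if $e,e'\in\mathbf{i}_{\max}$ with $e\subseteq e'$, then $\mathcal{B}_e\subseteq\mathcal{B}_{e'}$; (Independence) if $e,e_1,\ldots,e_l\in\mathbf{i}_{\max}$, then the $\sigma$-algebras $\mathcal{B}_e$ and $\bigvee_{i=1}^l\mathcal{B}_{e_i}$ are relatively independent conditioning on $\bigvee_{i=1}^l\mathcal{B}_{e\cap e_i}$. For each $e\in\mathbf{i}_{\max}$ let $E_e\in\mathcal{B}_e$ be an event, and suppose that $\mathbf{P}\big(\bigwedge_{e\in\mathbf{i}_{\max}}E_e\big)=0$. Then for every $\varepsilon>0$ there exist events $F_e\in\mathcal{B}_e\cap\mathcal{B}_{\mathrm{reg}}$ for all $e\in\mathbf{i}_{\max}$ such that $\mathbf{P}(E_e\setminus F_e)\le\varepsilon$ for all $e\in\mathbf{i}_{\max}$ and $\bigwedge_{e\in\mathbf{i}_{\max}}F_e=\emptyset$.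
   Context: A probability space $(\Omega,\mathcal{B}_{\max},\mathbf{P})$ here has $\mathcal{B}_{\max}$ a countably generated $\sigma$-algebra on $\Omega$. An algebra is a subset of $\mathcal{B}_{\max}$ containing $\emptyset,\Omega$ and closed under finite unions, intersections and complements. A factor is a countably generated sub-$\sigma$-algebra of $\mathcal{B}_{\max}$. For $\sigma$-algebras $\mathcal{B}_\alpha$, $\bigvee_\alpha\mathcal{B}_\alpha$ denotes the $\sigma$-algebra they generate (the empty join is $\{\emptyset,\Omega\}$). $\wedge$ denotes intersection of events. Two $\sigma$-algebras $\mathcal{B}_1,\mathcal{B}_2\subseteq\mathcal{B}_{\max}$ are relatively independent conditioning on a $\sigma$-algebra $\mathcal{B}$ if $\mathbf{E}(f_1f_2\mid\mathcal{B})=\mathbf{E}(f_1\mid\mathcal{B})\mathbf{E}(f_2\mid\mathcal{B})$ almost surely for all bounded $\mathcal{B}_1$-measurable $f_1$ and bounded $\mathcal{B}_2$-measurable $f_2$. A downset in $J$ is a collection $\mathbf{i}$ of subsets of $J$ such that $e\in\mathbf{i}$ and $e'\subseteq e$ imply $e'\in\mathbf{i}$. *)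

theory Defs
  imports "HOL-Probability.Probability"
begin

text \<open>
  Sigma-algebras on a fixed set \<open>\<Omega>\<close> are represented by their collections of events, of type
  \<open>'a set set\<close>; \<open>sigma \<Omega> B\<close> is used where the library expects a \<open>measure\<close>.
\<close>

definition countably_generated :: "'a set \<Rightarrow> 'a set set \<Rightarrow> bool" where
  "countably_generated \<Omega> B \<longleftrightarrow> (\<exists>G. countable G \<and> G \<subseteq> Pow \<Omega> \<and> B = sigma_sets \<Omega> G)"

definition factor :: "'a measure \<Rightarrow> 'a set set \<Rightarrow> bool" where
  "factor M B \<longleftrightarrow> sigma_algebra (space M) B \<and> B \<subseteq> sets M \<and> countably_generated (space M) B"

text \<open>For \<open>A = {}\<close> the join is \<open>{{}, \<Omega>}\<close>.\<close>

definition sigma_join :: "'a set \<Rightarrow> ('i \<Rightarrow> 'a set set) \<Rightarrow> 'i set \<Rightarrow> 'a set set" where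
  "sigma_join \<Omega> B A = sigma_sets \<Omega> (\<Union>i\<in>A. B i)"

text \<open>
  Meaningful only when \<open>B1\<close>, \<open>B2\<close> and \<open>B\<close> are sub-sigma-algebras of \<open>sets M\<close>.
\<close>

definition rel_indep :: "'a measure \<Rightarrow> 'a set set \<Rightarrow> 'a set set \<Rightarrow> 'a set set \<Rightarrow> bool" where
  "rel_indep M B1 B2 B \<longleftrightarrow>
    (\<forall>f1 f2 :: 'a \<Rightarrow> real.
      f1 \<in> borel_measurable (sigma (space M) B1) \<longrightarrow> bounded (f1 ` space M) \<longrightarrow>
      f2 \<in> borel_measurable (sigma (space M) B2) \<longrightarrow> bounded (f2 ` space M) \<longrightarrow>
      (AE x in M. real_cond_exp M (sigma (space M) B) (\<lambda>y. f1 y * f2 y) x =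
        real_cond_exp M (sigma (space M) B) f1 x * real_cond_exp M (sigma (space M) B) f2 x))"

definition downset :: "'j set \<Rightarrow> 'j set set \<Rightarrow> bool" where
  "downset J I \<longleftrightarrow> I \<subseteq> Pow J \<and> (\<forall>e\<in>I. \<forall>e'. e' \<subseteq> e \<longrightarrow> e' \<in> I)"

text \<open>Intersection taken inside \<open>\<Omega>\<close>, so that the empty intersection of events is \<open>\<Omega>\<close>.\<close>

definition event_Inter :: "'a set \<Rightarrow> ('i \<Rightarrow> 'a set) \<Rightarrow> 'i set \<Rightarrow> 'a set" where
  "event_Inter \<Omega> E A = \<Omega> \<inter> (\<Inter>i\<in>A. E i)"

end

theory Submission
  imports Defs
begin

text \<open>
  Induct on downsets \<open>I \<subseteq> Imax\<close>, allowing events \<open>D e\<close> that are measurable in the join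
  of the \<open>B f\<close> with \<open>f \<in> I\<close>, \<open>f \<subseteq> e\<close>, and looking for regular \<open>F e\<close> that nearly
  contain \<open>D e\<close> and whose intersection, if nonempty, forces the intersection of the \<open>D e\<close> to
  have positive measure.

  Remove a maximal \<open>g\<close> from \<open>I\<close> and cut \<open>\<Omega>\<close> into finitely many regular cells \<open>C \<in> B g\<close>.
  Inside a cell, replace each \<open>D e\<close> with \<open>g \<subseteq> e\<close> by the event that \<open>D e\<close> has conditional
  density close to \<open>1\<close> in \<open>C\<close>, given the join of the \<open>B f\<close> with \<open>f \<in> I - {g}\<close>,
  \<open>f \<subseteq> e\<close>. For a fine partition little of \<open>D e\<close> is lost. By independence these densities do
  not change when one conditions on all of \<open>I - {g}\<close>, so a union bound shows that the
  intersection of the \<open>D e\<close> has positive measure whenever that of the density events has.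
\<close>

section \<open>Conditional probability given a sub-sigma-algebra\<close>

context prob_space
begin

definition sub_sigma :: "'a set set \<Rightarrow> bool" where
  "sub_sigma K \<longleftrightarrow> sigma_algebra (space M) K \<and> K \<subseteq> events"

text \<open>This is \<open>P(A | K)\<close> in the version fixed by \<open>real_cond_exp\<close>, so
  bounds such as \<open>0 \<le> cprob K A x\<close> are available only almost everywhere.\<close>

definition cprob :: "'a set set \<Rightarrow> 'a set \<Rightarrow> 'a \<Rightarrow> real" where
  "cprob K A = real_cond_exp M (sigma (space M) K) (indicator A)"

lemma sets_sigma_sub_sigma: "sub_sigma K \<Longrightarrow> sets (sigma (space M) K) = K"
  using sigma_algebra.sets_measure_of_eq sub_sigma_def by blast

lemma subalgebra_sub_sigma: "sub_sigma K \<Longrightarrow> subalgebra M (sigma (space M) K)"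
  using sets_sigma_sub_sigma by (auto simp: subalgebra_def sub_sigma_def space_measure_of_conv)

lemma sigma_finite_subalgebra_sub_sigma:
  "sub_sigma K \<Longrightarrow> sigma_finite_subalgebra M (sigma (space M) K)"
  by (intro finite_measure_subalgebra_is_sigma_finite finite_measure_subalgebra.intro
      finite_measure_subalgebra_axioms.intro subalgebra_sub_sigma finite_measure_axioms)

lemma sub_sigma_sigma_sets: "G \<subseteq> events \<Longrightarrow> sub_sigma (sigma_sets (space M) G)"
  using sets.space_closed unfolding sub_sigma_def
  by (metis order_trans sets.sigma_sets_subset sigma_algebra_sigma_sets)

lemma sub_sigma_events: "sub_sigma K \<Longrightarrow> A \<in> K \<Longrightarrow> A \<in> events"
  by (auto simp: sub_sigma_def)

lemma measurable_sub_sigma: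
  "sub_sigma K \<Longrightarrow> f \<in> borel_measurable (sigma (space M) K) \<Longrightarrow> f \<in> borel_measurable M"
  using measurable_from_subalg subalgebra_sub_sigma by blast

lemma measurable_sub_sigma_mono:
  assumes "sub_sigma K" "sub_sigma H" "K \<subseteq> H" "f \<in> borel_measurable (sigma (space M) K)"
  shows "f \<in> borel_measurable (sigma (space M) H)"
proof -
  have "subalgebra (sigma (space M) H) (sigma (space M) K)"
    using assms sets_sigma_sub_sigma by (auto simp: subalgebra_def space_measure_of_conv)
  then show ?thesis
    using assms(4) measurable_from_subalg by blast
qed

lemma indicator_measurable_sub_sigma:
  "sub_sigma K \<Longrightarrow> A \<in> K \<Longrightarrow> (indicator A :: 'a \<Rightarrow> real) \<in> borel_measurable (sigma (space M) K)"
  by (intro borel_measurable_indicator) (simp add: sets_sigma_sub_sigma)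

lemma cprob_measurable_sub: "cprob K A \<in> borel_measurable (sigma (space M) K)"
  by (simp add: cprob_def)

lemma cprob_measurable [measurable]: "cprob K A \<in> borel_measurable M"
  by (simp add: cprob_def)

lemma integrable_bounded:
  fixes f :: "'a \<Rightarrow> real"
  assumes "f \<in> borel_measurable M" "bounded (f ` space M)"
  shows "integrable M f"
proof -
  obtain c where "\<And>x. x \<in> space M \<Longrightarrow> \<bar>f x\<bar> \<le> c"
    using assms(2) by (auto simp: bounded_iff)
  then show ?thesis
    using assms(1) by (intro integrable_const_bound[where B = c]) auto
qed

lemma integrable_indicator_event: "A \<in> events \<Longrightarrow> integrable M (indicator A :: 'a \<Rightarrow> real)"
  by (simp add: emeasure_eq_measure)

lemma integral_cprob:
  fixes f :: "'a \<Rightarrow> real"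
  assumes K: "sub_sigma K" and A: "A \<in> events"
    and f: "f \<in> borel_measurable (sigma (space M) K)" "bounded (f ` space M)"
  shows "(\<integral>x. f x * cprob K A x \<partial>M) = (\<integral>x. f x * indicator A x \<partial>M)"
    and "integrable M (\<lambda>x. f x * cprob K A x)"
proof -
  interpret F: sigma_finite_subalgebra M "sigma (space M) K"
    using K by (rule sigma_finite_subalgebra_sub_sigma)
  have fM: "f \<in> borel_measurable M"
    using K f(1) by (rule measurable_sub_sigma)
  have "integrable M (\<lambda>x. f x * indicator A x)"
    using integrable_real_mult_indicator[OF A integrable_bounded[OF fM f(2)]] by (simp add: mult.commute)
  from F.real_cond_exp_intg[OF this f(1)] A
  show "(\<integral>x. f x * cprob K A x \<partial>M) = (\<integral>x. f x * indicator A x \<partial>M)"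
    and "integrable M (\<lambda>x. f x * cprob K A x)"
    by (auto simp: cprob_def)
qed

lemma cprob_integrable: "sub_sigma K \<Longrightarrow> A \<in> events \<Longrightarrow> integrable M (cprob K A)"
  using integral_cprob(2)[of K A "\<lambda>_. 1"] by (auto simp: bounded_iff)

lemma AE_cprob_bounds:
  assumes "sub_sigma K" "A \<in> events"
  shows "AE x in M. 0 \<le> cprob K A x \<and> cprob K A x \<le> 1"
proof -
  interpret F: sigma_finite_subalgebra M "sigma (space M) K"
    using assms(1) by (rule sigma_finite_subalgebra_sub_sigma)
  have "integrable M (indicator A :: 'a \<Rightarrow> real)"
    using assms(2) by (rule integrable_indicator_event)
  from F.real_cond_exp_ge_c[OF this, of 0] F.real_cond_exp_le_c[OF this, of 1]
  show ?thesis
    by (auto simp: cprob_def indicator_def)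
qed

lemma integral_cprob_over:
  assumes "sub_sigma K" "A \<in> events" "S \<in> K"
  shows "(\<integral>x. indicator S x * cprob K A x \<partial>M) = prob (A \<inter> S)"
proof -
  have "(\<integral>x. indicator S x * cprob K A x \<partial>M) = (\<integral>x. indicator S x * indicator A x \<partial>M)"
    using assms by (intro integral_cprob indicator_measurable_sub_sigma)
      (auto simp: bounded_iff indicator_def)
  also have "\<dots> = (\<integral>x. indicator (A \<inter> S) x \<partial>M)"
    by (intro Bochner_Integration.integral_cong) (auto simp: indicator_def)
  also have "\<dots> = prob (A \<inter> S)"
    using assms sub_sigma_events by simp
  finally show ?thesis .
qed

text \<open>Integrating the factorisation of the conditional expectation against \<open>1\<close>.\<close>

lemma rel_indep_integral:
  fixes f :: "'a \<Rightarrow> real"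
  assumes sub: "sub_sigma B1" "sub_sigma B2" "sub_sigma L"
    and ri: "rel_indep M B1 B2 L"
    and A: "A \<in> B1"
    and f: "f \<in> borel_measurable (sigma (space M) B2)" "bounded (f ` space M)"
  shows "(\<integral>x. indicator A x * f x \<partial>M) = (\<integral>x. cprob L A x * f x \<partial>M)"
proof -
  interpret F: sigma_finite_subalgebra M "sigma (space M) L"
    using sub(3) by (rule sigma_finite_subalgebra_sub_sigma)
  have Ae: "A \<in> events"
    using A sub(1) sub_sigma_events by blast
  have fM: "f \<in> borel_measurable M"
    using sub(2) f(1) by (rule measurable_sub_sigma)
  have fi: "integrable M f"
    using fM f(2) by (rule integrable_bounded)
  obtain c where c: "\<And>x. x \<in> space M \<Longrightarrow> \<bar>f x\<bar> \<le> c"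
    using f(2) by (auto simp: bounded_iff)
  have Afi: "integrable M (\<lambda>x. indicator A x * f x)"
    using integrable_mult_indicator[OF Ae fi] by simp
  have pfi: "integrable M (\<lambda>x. cprob L A x * f x)"
  proof (rule integrable_const_bound[where B = c])
    show "AE x in M. norm (cprob L A x * f x) \<le> c"
      using AE_cprob_bounds[OF sub(3) Ae] AE_space
    proof eventually_elim
      case (elim x)
      then show ?case
        using c[of x] mult_mono[of "\<bar>cprob L A x\<bar>" 1 "\<bar>f x\<bar>" c] by (simp add: abs_mult)
    qed
  qed (use fM in measurable)
  have "(\<integral>x. indicator A x * f x \<partial>M) =
      (\<integral>x. real_cond_exp M (sigma (space M) L) (\<lambda>y. indicator A y * f y) x \<partial>M)"
    by (rule F.real_cond_exp_int(2)[OF Afi, symmetric])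
  also have "\<dots> = (\<integral>x. cprob L A x * real_cond_exp M (sigma (space M) L) f x \<partial>M)"
  proof (rule integral_cong_AE)
    have "bounded ((indicator A :: 'a \<Rightarrow> real) ` space M)"
      by (auto simp: bounded_iff indicator_def)
    then show "AE x in M. real_cond_exp M (sigma (space M) L) (\<lambda>y. indicator A y * f y) x =
        cprob L A x * real_cond_exp M (sigma (space M) L) f x"
      using ri f indicator_measurable_sub_sigma[OF sub(1) A]
      unfolding rel_indep_def cprob_def by blast
  qed (use fM in measurable)
  \<comment> \<open>Since \<open>cprob L A\<close> is \<open>L\<close>-measurable, the conditional
    expectation may be dropped from the other factor under the integral.\<close>
  also have "\<dots> = (\<integral>x. cprob L A x * f x \<partial>M)"
    using pfi by (rule F.real_cond_exp_intg(2)) (use fM cprob_measurable_sub in auto)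
  finally show ?thesis .
qed


text \<open>A test function in \<open>integral_cprob\<close> must be bounded at every point.
  Clipping to \<open>[0, 1]\<close> achieves this, keeps \<open>K\<close>-measurability and changes
  values only on a null set.\<close>

lemma cprob_version:
  assumes "sub_sigma K" "A \<in> events"
  obtains q where "q \<in> borel_measurable (sigma (space M) K)" "\<And>x. 0 \<le> q x" "\<And>x. q x \<le> 1"
    "AE x in M. q x = cprob K A x"
proof
  show "(\<lambda>x. max 0 (min 1 (cprob K A x))) \<in> borel_measurable (sigma (space M) K)"
    using cprob_measurable_sub[of K A] by measurable
  show "AE x in M. max 0 (min 1 (cprob K A x)) = cprob K A x"
    using AE_cprob_bounds[OF assms] by eventually_elim simp
qed auto

text \<open>Conditional expectation is self-adjoint: both sides equal the integral of
  \<open>cprob K A x * cprob K S x\<close>.\<close>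

lemma integral_cprob_commute:
  assumes K: "sub_sigma K" and A: "A \<in> events" and S: "S \<in> events"
  shows "(\<integral>x. indicator S x * cprob K A x \<partial>M) = (\<integral>x. indicator A x * cprob K S x \<partial>M)"
proof -
  obtain p where p: "p \<in> borel_measurable (sigma (space M) K)" "\<And>x. 0 \<le> p x" "\<And>x. p x \<le> 1"
    "AE x in M. p x = cprob K A x"
    using cprob_version[OF K A] by blast
  obtain q where q: "q \<in> borel_measurable (sigma (space M) K)" "\<And>x. 0 \<le> q x" "\<And>x. q x \<le> 1"
    "AE x in M. q x = cprob K S x"
    using cprob_version[OF K S] by blast
  have [measurable]: "p \<in> borel_measurable M" "q \<in> borel_measurable M"
    using K p(1) q(1) measurable_sub_sigma by blast+
  note [measurable] = A S
  have b: "bounded (p ` space M)" "bounded (q ` space M)"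
    using p q by (auto simp: bounded_iff abs_le_iff intro!: exI[of _ 1])
      (meson dual_order.trans le_minus_one_simps(1) neg_le_iff_le)+
  have "(\<integral>x. indicator S x * cprob K A x \<partial>M) = (\<integral>x. p x * indicator S x \<partial>M)"
    by (rule integral_cong_AE) (use p(4) in auto)
  also have "\<dots> = (\<integral>x. p x * cprob K S x \<partial>M)"
    by (rule integral_cprob(1)[symmetric]) (use K S p(1) b in auto)
  also have "\<dots> = (\<integral>x. q x * cprob K A x \<partial>M)"
    by (rule integral_cong_AE) (use p(4) q(4) in auto)
  also have "\<dots> = (\<integral>x. q x * indicator A x \<partial>M)"
    by (rule integral_cprob(1)) (use K A q(1) b in auto)
  also have "\<dots> = (\<integral>x. indicator A x * cprob K S x \<partial>M)"
    by (rule integral_cong_AE) (use q(4) in auto)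
  finally show ?thesis .
qed

section \<open>Conditional probabilities under relative independence\<close>

text \<open>Independence replaces \<open>a\<close> by \<open>P(a | L)\<close>, which is
  \<open>K\<close>-measurable because \<open>L \<subseteq> K\<close>. It is then a legitimate test
  function, so \<open>P(S | K)\<close> turns into \<open>S\<close>; a second use of independence
  brings \<open>a\<close> back.\<close>

lemma rel_indep_integral_cprob:
  assumes sub: "sub_sigma B1" "sub_sigma H" "sub_sigma L" "sub_sigma K"
    and LK: "L \<subseteq> K" and KH: "K \<subseteq> H"
    and ri: "rel_indep M B1 H L"
    and a: "a \<in> B1" and k: "k \<in> K" and S: "S \<in> H"
  shows "(\<integral>x. indicator (a \<inter> k) x * cprob K S x \<partial>M) = prob (a \<inter> k \<inter> S)"
proof -
  have ev [measurable]: "a \<in> events" "k \<in> events" "S \<in> events"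
    using a k S sub sub_sigma_events by blast+
  obtain p where p: "p \<in> borel_measurable (sigma (space M) L)" "\<And>x. 0 \<le> p x" "\<And>x. p x \<le> 1"
    "AE x in M. p x = cprob L a x"
    using cprob_version[OF sub(3) ev(1)] by blast
  obtain q where q: "q \<in> borel_measurable (sigma (space M) K)" "\<And>x. 0 \<le> q x" "\<And>x. q x \<le> 1"
    "AE x in M. q x = cprob K S x"
    using cprob_version[OF sub(4) ev(3)] by blast
  have [measurable]: "p \<in> borel_measurable M" "q \<in> borel_measurable M"
    using sub p(1) q(1) measurable_sub_sigma by blast+
  have kK: "(indicator k :: 'a \<Rightarrow> real) \<in> borel_measurable (sigma (space M) K)"
    using indicator_measurable_sub_sigma sub(4) k by blast
  have pK: "p \<in> borel_measurable (sigma (space M) K)"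
    using measurable_sub_sigma_mono sub LK p(1) by blast
  have pkK: "(\<lambda>x. p x * indicator k x) \<in> borel_measurable (sigma (space M) K)"
    using kK pK by (rule borel_measurable_times[rotated])
  have kqH: "(\<lambda>x. indicator k x * q x) \<in> borel_measurable (sigma (space M) H)"
    by (rule measurable_sub_sigma_mono[OF sub(4) sub(2) KH]) (use kK q(1) in measurable)
  have kSH: "(indicator (k \<inter> S) :: 'a \<Rightarrow> real) \<in> borel_measurable (sigma (space M) H)"
    using indicator_measurable_sub_sigma[OF sub(2), of "k \<inter> S"] k S KH sub(2)
    by (metis sets.Int sets_sigma_sub_sigma subsetD)
  have "(\<integral>x. indicator (a \<inter> k) x * cprob K S x \<partial>M) = (\<integral>x. indicator a x * (indicator k x * q x) \<partial>M)"
    by (rule integral_cong_AE) (use q(4) in \<open>auto simp: indicator_inter_arith\<close>)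
  also have "\<dots> = (\<integral>x. cprob L a x * (indicator k x * q x) \<partial>M)"
    by (rule rel_indep_integral[OF sub(1-3) ri a kqH])
      (use q in \<open>auto simp: bounded_iff indicator_def intro!: exI[of _ 1]\<close>)
  also have "\<dots> = (\<integral>x. (p x * indicator k x) * cprob K S x \<partial>M)"
    by (rule integral_cong_AE) (use q(4) p(4) in auto)
  also have "\<dots> = (\<integral>x. (p x * indicator k x) * indicator S x \<partial>M)"
    by (rule integral_cprob(1)[OF sub(4) ev(3) pkK])
      (use p in \<open>auto simp: bounded_iff indicator_def intro!: exI[of _ 1]\<close>)
  also have "\<dots> = (\<integral>x. cprob L a x * indicator (k \<inter> S) x \<partial>M)"
    by (rule integral_cong_AE) (use p(4) in \<open>auto simp: indicator_inter_arith\<close>)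
  also have "\<dots> = (\<integral>x. indicator a x * indicator (k \<inter> S) x \<partial>M)"
    by (rule rel_indep_integral[OF sub(1-3) ri a kSH, symmetric])
      (auto simp: bounded_iff indicator_def)
  also have "\<dots> = (\<integral>x. indicator (a \<inter> k \<inter> S) x \<partial>M)"
    by (intro Bochner_Integration.integral_cong) (auto simp: indicator_def)
  also have "\<dots> = prob (a \<inter> k \<inter> S)"
    using ev by simp
  finally show ?thesis .
qed

text \<open>In other words, \<open>E(1\<^sub>A | H) = E(1\<^sub>A | K)\<close> for \<open>A\<close> in the join of \<open>B1\<close> and \<open>K\<close>.\<close>

lemma rel_indep_integral_cprob_over:
  assumes sub: "sub_sigma B1" "sub_sigma H" "sub_sigma L" "sub_sigma K"
    and LK: "L \<subseteq> K" and KH: "K \<subseteq> H"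
    and ri: "rel_indep M B1 H L"
    and A: "A \<in> sigma_sets (space M) (B1 \<union> K)" and S: "S \<in> H"
  shows "(\<integral>x. indicator S x * cprob K A x \<partial>M) = prob (A \<inter> S)"
proof -
  \<comment> \<open>A pi-system generating the join of \<open>B1\<close> and
    \<open>K\<close>.\<close>
  define G where "G = {a \<inter> k | a k. a \<in> B1 \<and> k \<in> K}"
  have B1K: "B1 \<union> K \<subseteq> events"
    using sub by (auto simp: sub_sigma_def)
  have Gev: "G \<subseteq> events"
    using B1K by (auto simp: G_def)
  have Se: "S \<in> events"
    using S sub(2) sub_sigma_events by blast
  have spc: "space M \<in> B1" "space M \<in> K"
    using sub sigma_algebra.sigma_sets_eq sigma_sets_top unfolding sub_sigma_def by blast+
  have "B1 \<union> K \<subseteq> G"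
  proof
    fix a assume a: "a \<in> B1 \<union> K"
    then have "a = a \<inter> space M" "a = space M \<inter> a"
      using B1K sets.sets_into_space by blast+
    then show "a \<in> G"
      using a spc unfolding G_def by blast
  qed
  then have AG: "A \<in> sigma_sets (space M) G"
    using A sigma_sets_mono' by blast
  have sg: "sigma_sets (space M) G \<subseteq> events"
    using Gev by (rule sets.sigma_sets_subset)
  have int: "integrable M (cprob K S)"
    using sub(4) Se by (rule cprob_integrable)
  have total: "(\<integral>x. cprob K S x \<partial>M) = prob S"
  proof -
    have "(\<integral>x. cprob K S x \<partial>M) = (\<integral>x. indicator (space M) x * cprob K S x \<partial>M)"
      by (intro Bochner_Integration.integral_cong) auto
    then show ?thesis
      using integral_cprob_over[OF sub(4) Se spc(2)] Se by simp
  qed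
  \<comment> \<open>The claim is proved with \<open>A\<close> and \<open>S\<close> exchanged under
    the integral. In this form \<open>A\<close> is only the domain of integration of one fixed
    integrable function, so the identity passes to complements and disjoint unions, and the
    pi-lambda theorem applies.\<close>
  have "(\<integral>x. indicator A x * cprob K S x \<partial>M) = prob (A \<inter> S)"
  proof (rule sigma_sets_induct_disjoint[OF _ _ AG])
    show "Int_stable G"
    proof (rule Int_stableI)
      fix u v assume "u \<in> G" "v \<in> G"
      then obtain a b k l where "u = a \<inter> k" "v = b \<inter> l" "a \<in> B1" "b \<in> B1" "k \<in> K" "l \<in> K"
        unfolding G_def by blast
      moreover from this have "a \<inter> b \<in> B1" "k \<inter> l \<in> K"
        using sub sets_sigma_sub_sigma by (metis sets.Int)+
      moreover have "(a \<inter> k) \<inter> (b \<inter> l) = (a \<inter> b) \<inter> (k \<inter> l)"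
        by blast
      ultimately show "u \<inter> v \<in> G"
        unfolding G_def by blast
    qed
    show "G \<subseteq> Pow (space M)"
      using Gev sets.sets_into_space by blast
  next
    fix a assume "a \<in> G"
    then show "(\<integral>x. indicator a x * cprob K S x \<partial>M) = prob (a \<inter> S)"
      using rel_indep_integral_cprob[OF sub LK KH ri _ _ S] by (auto simp: G_def)
  next
    show "(\<integral>x. indicator {} x * cprob K S x \<partial>M) = prob ({} \<inter> S)"
      by simp
  next
    fix a assume a: "a \<in> sigma_sets (space M) G"
      and IH: "(\<integral>x. indicator a x * cprob K S x \<partial>M) = prob (a \<inter> S)"
    have ae: "a \<in> events"
      using a sg by blast
    have "(\<integral>x. indicator (space M - a) x * cprob K S x \<partial>M) =
        (\<integral>x. cprob K S x - indicator a x * cprob K S x \<partial>M)"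
      by (intro Bochner_Integration.integral_cong) (auto simp: indicator_def)
    also have "\<dots> = prob S - prob (a \<inter> S)"
      using int integrable_mult_indicator[OF ae int] total IH
      by (subst Bochner_Integration.integral_diff) auto
    also have "\<dots> = prob (S - a)"
      using finite_measure_Diff'[OF Se ae] by (simp add: Int_commute)
    also have "S - a = (space M - a) \<inter> S"
      using Se sets.sets_into_space by blast
    finally show "(\<integral>x. indicator (space M - a) x * cprob K S x \<partial>M) = prob ((space M - a) \<inter> S)" .
  next
    fix F :: "nat \<Rightarrow> 'a set"
    assume F: "disjoint_family F" "range F \<subseteq> sigma_sets (space M) G"
      and IH: "\<And>i. (\<integral>x. indicator (F i) x * cprob K S x \<partial>M) = prob (F i \<inter> S)"
    have Fe: "F i \<in> events" for i
      using F(2) sg by blast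
    have "set_integrable M (\<Union>i. F i) (cprob K S)"
      unfolding set_integrable_def using Fe int by (intro integrable_mult_indicator) auto
    then have "(LINT x:(\<Union>i. F i)|M. cprob K S x) = (\<Sum>i. LINT x:F i|M. cprob K S x)"
      using Fe F(1) by (intro lebesgue_integral_countable_add) (auto simp: disjoint_family_on_def)
    also have "\<dots> = (\<Sum>i. prob (F i \<inter> S))"
      using IH by (simp add: set_lebesgue_integral_def)
    also have "\<dots> = prob (\<Union>i. F i \<inter> S)"
      using F(1) Fe Se by (intro sums_unique[symmetric] finite_measure_UNION)
        (auto simp: disjoint_family_on_def)
    finally show "(\<integral>x. indicator (\<Union>i. F i) x * cprob K S x \<partial>M) = prob ((\<Union>i. F i) \<inter> S)"
      by (simp add: set_lebesgue_integral_def)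
  qed
  then show ?thesis
    using integral_cprob_commute[OF sub(4) _ Se] AG sg by auto
qed

end

section \<open>Finite partitions into cells, and approximation on them\<close>

text \<open>The index records which of the first \<open>m\<close> generators contain
  \<open>x\<close>. Points with equal index form a cell, so the nonempty cells are the atoms of the
  finite algebra generated by \<open>G 0\<close>, ..., \<open>G (m - 1)\<close>.\<close>

definition cell_index :: "(nat \<Rightarrow> 'a set) \<Rightarrow> nat \<Rightarrow> 'a \<Rightarrow> nat set" where
  "cell_index G m x = {i. i < m \<and> x \<in> G i}"

definition cell :: "'a set \<Rightarrow> (nat \<Rightarrow> 'a set) \<Rightarrow> nat \<Rightarrow> nat set \<Rightarrow> 'a set" where
  "cell \<Omega> G m s = {x \<in> \<Omega>. cell_index G m x = s}"

lemma cell_index_subset: "cell_index G m x \<in> Pow {..<m}"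
  by (auto simp: cell_index_def)

text \<open>Only finite Boolean operations occur, so the cells inherit regularity from an algebra of
  regular events just as they inherit measurability from a sigma-algebra.\<close>

lemma cell_in_algebra:
  assumes "algebra \<Omega> A" "range G \<subseteq> A"
  shows "cell \<Omega> G m s \<in> A"
proof (cases "s \<subseteq> {..<m}")
  case True
  interpret algebra \<Omega> A by fact
  have G: "{x \<in> \<Omega>. x \<in> G i} \<in> A" for i
  proof -
    have "{x \<in> \<Omega>. x \<in> G i} = G i"
      using assms(2) sets_into_space by blast
    then show ?thesis
      using assms(2) by auto
  qed
  have "{x \<in> \<Omega>. \<forall>i\<in>{..<m}. x \<in> G i \<longleftrightarrow> i \<in> s} \<in> A"
  proof (rule sets_Collect_finite_All)
    fix i show "{x \<in> \<Omega>. x \<in> G i \<longleftrightarrow> i \<in> s} \<in> A"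
      using G[of i] sets_Collect_neg[OF G[of i]] by (cases "i \<in> s") auto
  qed simp
  also have "{x \<in> \<Omega>. \<forall>i\<in>{..<m}. x \<in> G i \<longleftrightarrow> i \<in> s} = cell \<Omega> G m s"
    using True by (auto simp: cell_def cell_index_def)
  finally show ?thesis .
next
  case False
  \<comment> \<open>An index that is not a subset of \<open>{..<m}\<close> is never attained; hence
    \<open>s\<close> can stay unrestricted.\<close>
  then have "cell \<Omega> G m s = {}"
    using cell_index_subset by (fastforce simp: cell_def)
  then show ?thesis
    using assms(1) by (simp add: algebra_iff_Un)
qed

context prob_space
begin

lemma sub_sigma_algebra: "sub_sigma K \<Longrightarrow> algebra (space M) K"
  by (simp add: sub_sigma_def sigma_algebra.axioms(1))

lemma cell_events: "range G \<subseteq> events \<Longrightarrow> cell (space M) G m s \<in> events"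
  by (rule cell_in_algebra[OF sets.algebra_axioms])

lemma cell_index_selection_events:
  assumes "range G \<subseteq> events" "\<And>s. k s \<in> events"
  shows "{x \<in> space M. x \<in> k (cell_index G m x)} \<in> events"
proof -
  have "{x \<in> space M. x \<in> k (cell_index G m x)} = (\<Union>s\<in>Pow {..<m}. cell (space M) G m s \<inter> k s)"
    using cell_index_subset[of G m] by (auto simp: cell_def)
  also have "\<dots> \<in> events"
    by (intro sets.finite_UN sets.Int cell_events assms) simp
  finally show ?thesis .
qed

text \<open>The approximating set agrees with the member \<open>k s\<close> of \<open>K\<close> on
  the cell of index \<open>s\<close>. Asking for all large \<open>m\<close>, not just one, lets
  finitely many approximations share a partition; the union case already relies on this.\<close>

lemma sigma_sets_approximation:
  assumes K: "sub_sigma K" and G: "range G \<subseteq> events"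
    and D: "D \<in> sigma_sets (space M) (range G \<union> K)"
  shows "\<forall>\<eta>>0. \<exists>n. \<forall>m\<ge>n. \<exists>k. (\<forall>s. k s \<in> K) \<and>
    prob (sym_diff D {x \<in> space M. x \<in> k (cell_index G m x)}) < \<eta>"
  using D
proof induction
  case (Basic a)
  interpret K: sigma_algebra "space M" K
    using K by (simp add: sub_sigma_def)
  show ?case
  proof (intro allI impI)
    fix \<eta> :: real assume "\<eta> > 0"
    show "\<exists>n. \<forall>m\<ge>n. \<exists>k. (\<forall>s. k s \<in> K) \<and>
      prob (sym_diff a {x \<in> space M. x \<in> k (cell_index G m x)}) < \<eta>"
    proof (cases "a \<in> K")
      case True
      then have "a = {x \<in> space M. x \<in> a}"
        using K.sets_into_space by blast
      then show ?thesis
        using True \<open>\<eta> > 0\<close> by (intro exI[of _ 0] allI impI exI[of _ "\<lambda>_. a"]) auto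
    next
      case False
      then obtain i where i: "a = G i"
        using Basic by auto
      \<comment> \<open>Once \<open>m > i\<close>, the index of a cell decides membership in
        \<open>G i\<close>. Selecting everything or nothing on each cell then reproduces
        \<open>G i\<close> exactly.\<close>
      have "prob (sym_diff a {x \<in> space M. x \<in> (if i \<in> cell_index G m x then space M else {})}) = 0"
        if "m \<ge> Suc i" for m
      proof -
        have "G i \<subseteq> space M"
          using G sets.sets_into_space by blast
        then have "{x \<in> space M. x \<in> (if i \<in> cell_index G m x then space M else {})} = G i"
          using that by (auto simp: cell_index_def split: if_splits)
        then show ?thesis
          by (simp add: i)
      qed
      then show ?thesis
        using \<open>\<eta> > 0\<close>
        by (intro exI[of _ "Suc i"] allI impI exI[of _ "\<lambda>s. if i \<in> s then space M else {}"])
          simp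
    qed
  qed
next
  case Empty
  interpret K: sigma_algebra "space M" K
    using K by (simp add: sub_sigma_def)
  show ?case
    by (intro allI impI exI[of _ 0] exI[of _ "\<lambda>_. {}"]) auto
next
  case (Compl a)
  interpret K: sigma_algebra "space M" K
    using K by (simp add: sub_sigma_def)
  have aK: "a \<subseteq> space M"
    using Compl.hyps sigma_sets_into_sp[of "range G \<union> K" "space M" a] G K.space_closed
      sets.space_closed by blast
  show ?case
  proof (intro allI impI)
    fix \<eta> :: real assume "\<eta> > 0"
    then obtain n where n: "\<And>m. m \<ge> n \<Longrightarrow> \<exists>k. (\<forall>s. k s \<in> K) \<and>
        prob (sym_diff a {x \<in> space M. x \<in> k (cell_index G m x)}) < \<eta>"
      using Compl.IH by blast
    show "\<exists>n. \<forall>m\<ge>n. \<exists>k. (\<forall>s. k s \<in> K) \<and>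
        prob (sym_diff (space M - a) {x \<in> space M. x \<in> k (cell_index G m x)}) < \<eta>"
    proof (intro exI[of _ n] allI impI)
      fix m assume "m \<ge> n"
      then obtain k where k: "\<And>s. k s \<in> K"
        "prob (sym_diff a {x \<in> space M. x \<in> k (cell_index G m x)}) < \<eta>"
        using n by blast
      have "sym_diff (space M - a) {x \<in> space M. x \<in> space M - k (cell_index G m x)} =
          sym_diff a {x \<in> space M. x \<in> k (cell_index G m x)}"
        using aK by blast
      then show "\<exists>k. (\<forall>s. k s \<in> K) \<and>
          prob (sym_diff (space M - a) {x \<in> space M. x \<in> k (cell_index G m x)}) < \<eta>"
        using k by (intro exI[of _ "\<lambda>s. space M - k s"]) auto
    qed
  qed
next
  case (Union a)
  interpret K: sigma_algebra "space M" K
    using K by (simp add: sub_sigma_def)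
  have GK: "sigma_sets (space M) (range G \<union> K) \<subseteq> events"
    using G K by (intro sets.sigma_sets_subset) (auto simp: sub_sigma_def)
  have ae [measurable]: "a i \<in> events" for i
    using Union.hyps GK by blast
  show ?case
  proof (intro allI impI)
    fix \<eta> :: real assume \<eta>: "\<eta> > 0"
    \<comment> \<open>By continuity from below a finite part of the union suffices up to
      \<open>\<eta> / 2\<close>; the other half is shared among its \<open>N\<close>
      members.\<close>
    let ?u = "\<lambda>N. \<Union>i<N. a i"
    have "(\<lambda>N. prob (?u N)) \<longlonglongrightarrow> prob (\<Union>N. ?u N)"
      by (rule finite_Lim_measure_incseq) (auto simp: incseq_def intro: less_le_trans)
    also have "(\<Union>N. ?u N) = (\<Union>i. a i)"
      by blast
    finally have "(\<lambda>N. prob (?u N)) \<longlonglongrightarrow> prob (\<Union>i. a i)" .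
    then obtain N where N: "\<bar>prob (?u N) - prob (\<Union>i. a i)\<bar> < \<eta> / 2"
      using \<eta> by (metis LIMSEQ_D half_gt_zero order_refl real_norm_def)
    have tail: "prob ((\<Union>i. a i) - ?u N) < \<eta> / 2"
      using N abs_ge_minus_self[of "prob (?u N) - prob (\<Union>i. a i)"]
      by (subst finite_measure_Diff) auto
    \<comment> \<open>The summand \<open>1\<close> keeps the denominator positive when
      \<open>N = 0\<close>.\<close>
    define \<theta> where "\<theta> = \<eta> / (2 * (real N + 1))"
    have \<theta>: "\<theta> > 0" "real N * \<theta> \<le> \<eta> / 2"
      using \<eta> by (auto simp: \<theta>_def field_simps)
    have "\<forall>i. \<exists>n. \<forall>m\<ge>n. \<exists>k. (\<forall>s. k s \<in> K) \<and>
        prob (sym_diff (a i) {x \<in> space M. x \<in> k (cell_index G m x)}) < \<theta>"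
      using Union.IH \<theta>(1) by blast
    from choice[OF this] obtain n where n: "\<forall>i. \<forall>m\<ge>n i. \<exists>k. (\<forall>s. k s \<in> K) \<and>
        prob (sym_diff (a i) {x \<in> space M. x \<in> k (cell_index G m x)}) < \<theta>" ..
    show "\<exists>n. \<forall>m\<ge>n. \<exists>k. (\<forall>s. k s \<in> K) \<and>
        prob (sym_diff (\<Union>i. a i) {x \<in> space M. x \<in> k (cell_index G m x)}) < \<eta>"
    \<comment> \<open>The sum serves as a common upper bound of the thresholds and also covers
      \<open>N = 0\<close>.\<close>
    proof (intro exI[of _ "\<Sum>i<N. n i"] allI impI)
      fix m assume m: "m \<ge> (\<Sum>i<N. n i)"
      have "\<forall>i\<in>{..<N}. \<exists>k. (\<forall>s. k s \<in> K) \<and>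
          prob (sym_diff (a i) {x \<in> space M. x \<in> k (cell_index G m x)}) < \<theta>"
      proof
        fix i assume "i \<in> {..<N}"
        then have "n i \<le> (\<Sum>i<N. n i)"
          by (intro member_le_sum) auto
        then show "\<exists>k. (\<forall>s. k s \<in> K) \<and>
            prob (sym_diff (a i) {x \<in> space M. x \<in> k (cell_index G m x)}) < \<theta>"
          using m by (intro n[rule_format]) simp
      qed
      from bchoice[OF this] obtain k where k': "\<forall>i\<in>{..<N}. (\<forall>s. k i s \<in> K) \<and>
          prob (sym_diff (a i) {x \<in> space M. x \<in> k i (cell_index G m x)}) < \<theta>" ..
      then have k: "\<And>i s. i < N \<Longrightarrow> k i s \<in> K"
        "\<And>i. i < N \<Longrightarrow> prob (sym_diff (a i) {x \<in> space M. x \<in> k i (cell_index G m x)}) < \<theta>"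
        by (simp_all only: lessThan_iff Ball_def)
      let ?S = "\<lambda>i. {x \<in> space M. x \<in> k i (cell_index G m x)}"
      let ?T = "{x \<in> space M. x \<in> (\<Union>i<N. k i (cell_index G m x))}"
      have Se [measurable]: "?S i \<in> events" if "i < N" for i
        using cell_index_selection_events[OF G, of "k i"] k(1)[OF that] sub_sigma_events[OF K] by blast
      have sd: "sym_diff (a i) (?S i) \<in> events" if "i < N" for i
        using Se[OF that] ae[of i] by (intro sets.Un sets.Diff)
      have "sym_diff (\<Union>i. a i) ?T \<subseteq> ((\<Union>i. a i) - ?u N) \<union> (\<Union>i<N. sym_diff (a i) (?S i))"
        using ae[THEN sets.sets_into_space] by blast
      then have "prob (sym_diff (\<Union>i. a i) ?T) \<le>
          prob (((\<Union>i. a i) - ?u N) \<union> (\<Union>i<N. sym_diff (a i) (?S i)))"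
        using sd by (intro finite_measure_mono) auto
      also have "\<dots> \<le> prob ((\<Union>i. a i) - ?u N) + prob (\<Union>i<N. sym_diff (a i) (?S i))"
        using sd by (intro measure_Un_le) auto
      also have "prob (\<Union>i<N. sym_diff (a i) (?S i)) \<le> (\<Sum>i<N. prob (sym_diff (a i) (?S i)))"
        using sd by (intro finite_measure_subadditive_finite) auto
      also have "\<dots> \<le> (\<Sum>i<N. \<theta>)"
        using k(2) by (intro sum_mono) (auto intro: less_imp_le)
      also have "\<dots> \<le> \<eta> / 2"
        using \<theta>(2) by simp
      finally have "prob (sym_diff (\<Union>i. a i) ?T) < \<eta>"
        using tail by simp
      then show "\<exists>k. (\<forall>s. k s \<in> K) \<and>
          prob (sym_diff (\<Union>i. a i) {x \<in> space M. x \<in> k (cell_index G m x)}) < \<eta>"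
        using k(1) by (intro exI[of _ "\<lambda>s. \<Union>i<N. k i s"]) auto
    qed
  qed
qed

section \<open>Sets of high conditional density\<close>

lemma integral_indicator_mono:
  fixes f g :: "'a \<Rightarrow> real"
  assumes S: "S \<in> events" and f: "integrable M f" and g: "integrable M g"
    and le: "\<And>x. x \<in> S \<Longrightarrow> f x \<le> g x"
  shows "(\<integral>x. indicator S x * f x \<partial>M) \<le> (\<integral>x. indicator S x * g x \<partial>M)"
  using integrable_mult_indicator[OF S f] integrable_mult_indicator[OF S g] le
  by (intro integral_mono) (auto simp: indicator_def)

text \<open>Here \<open>D\<close> has conditional density above \<open>1 - \<delta>\<close> in
  \<open>C\<close>. The multiplied-out form avoids a quotient where \<open>cprob K C\<close>
  vanishes, and for \<open>\<delta> > 0\<close> the strict inequality makes \<open>cprob K C\<close>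
  positive almost everywhere on the set.\<close>

definition density_set :: "'a set set \<Rightarrow> real \<Rightarrow> 'a set \<Rightarrow> 'a set \<Rightarrow> 'a set" where
  "density_set K \<delta> C D = {x \<in> space M. cprob K (C - D) x < \<delta> * cprob K C x}"

lemma density_set_in: "sub_sigma K \<Longrightarrow> density_set K \<delta> C D \<in> K"
proof -
  assume K: "sub_sigma K"
  have "{x \<in> space (sigma (space M) K). cprob K (C - D) x < \<delta> * cprob K C x} \<in> sets (sigma (space M) K)"
    using cprob_measurable_sub[of K C] cprob_measurable_sub[of K "C - D"] by measurable
  then show "density_set K \<delta> C D \<in> K"
    using K by (simp add: density_set_def sets_sigma_sub_sigma space_measure_of_conv)
qed

text \<open>An argument of Markov type: outside the density set
  \<open>\<delta> * P(C | K) \<le> P(C - D | K)\<close>, and both sides are integrated over a set in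
  \<open>K\<close>.\<close>

lemma prob_outside_density_set:
  assumes K: "sub_sigma K" and C: "C \<in> events" and D: "D \<in> events" and k: "k \<in> K" and \<delta>: "\<delta> > 0"
  shows "prob (C \<inter> (k - density_set K \<delta> C D)) \<le> prob ((C - D) \<inter> k) / \<delta>"
proof -
  interpret K: sigma_algebra "space M" K
    using K by (simp add: sub_sigma_def)
  let ?S = "k - density_set K \<delta> C D"
  have S: "?S \<in> K"
    using k density_set_in[OF K] by blast
  have "\<delta> * prob (C \<inter> ?S) = \<delta> * (\<integral>x. indicator ?S x * cprob K C x \<partial>M)"
    using integral_cprob_over[OF K C S] by simp
  also have "\<dots> = (\<integral>x. indicator ?S x * (\<delta> * cprob K C x) \<partial>M)"
    by (simp add: mult.left_commute flip: integral_mult_right_zero)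
  also have "\<dots> \<le> (\<integral>x. indicator ?S x * cprob K (C - D) x \<partial>M)"
    using S K C D K.sets_into_space[OF k]
    by (intro integral_indicator_mono sub_sigma_events[OF K S] integrable_mult_right cprob_integrable)
      (auto simp: density_set_def not_less)
  also have "\<dots> = prob ((C - D) \<inter> ?S)"
    using C D by (intro integral_cprob_over[OF K _ S]) auto
  also have "\<dots> \<le> prob ((C - D) \<inter> k)"
    using C D sub_sigma_events[OF K k] by (intro finite_measure_mono) auto
  finally show ?thesis
    using \<delta> by (simp add: field_simps)
qed

text \<open>With \<open>D\<close> approximated by \<open>k s\<close> on each cell, there are two
  losses: the part of \<open>D\<close> missed by the approximation, and the part of
  \<open>k s\<close> of low density, which the Markov bound controls.\<close>

lemma prob_cells_outside_density_sets:
  assumes K: "sub_sigma K" and G: "range G \<subseteq> events"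
    and D: "D \<in> sigma_sets (space M) (range G \<union> K)" and \<delta>: "\<delta> > 0" and \<eta>: "\<eta> > 0"
  shows "\<exists>n. \<forall>m\<ge>n. prob (\<Union>s\<in>Pow {..<m}. cell (space M) G m s \<inter> D
    - density_set K \<delta> (cell (space M) G m s) D) \<le> \<eta>"
proof -
  interpret K: sigma_algebra "space M" K
    using K by (simp add: sub_sigma_def)
  have De: "D \<in> events"
    using D G K sets.sigma_sets_subset[of "range G \<union> K" M] by (auto simp: sub_sigma_def)
  \<comment> \<open>Solves \<open>\<theta> + \<theta> / \<delta> = \<eta>\<close>, the sum of the
    two losses.\<close>
  define \<theta> where "\<theta> = \<eta> * \<delta> / (\<delta> + 1)"
  have \<theta>: "\<theta> > 0" "\<theta> + \<theta> / \<delta> = \<eta>"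
    using \<delta> \<eta> by (auto simp: \<theta>_def divide_simps) (simp add: algebra_simps)
  obtain n where n: "\<And>m. m \<ge> n \<Longrightarrow> \<exists>k. (\<forall>s. k s \<in> K) \<and>
      prob (sym_diff D {x \<in> space M. x \<in> k (cell_index G m x)}) < \<theta>"
    using sigma_sets_approximation[OF K G D] \<theta>(1) by blast
  show ?thesis
  proof (intro exI[of _ n] allI impI)
    fix m assume "m \<ge> n"
    then obtain k where k: "\<And>s. k s \<in> K" "prob (sym_diff D {x \<in> space M. x \<in> k (cell_index G m x)}) < \<theta>"
      using n by blast
    let ?C = "cell (space M) G m" and ?D = "{x \<in> space M. x \<in> k (cell_index G m x)}"
    let ?P = "Pow {..<m}"
    let ?Z = "\<lambda>s. density_set K \<delta> (?C s) D"
    have Ce: "?C s \<in> events" for s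
      using G by (rule cell_events)
    have ke: "k s \<in> events" for s
      using K k(1) sub_sigma_events by blast
    have De': "?D \<in> events"
      using G ke by (rule cell_index_selection_events)
    have Ze: "?Z s \<in> events" for s
      using K density_set_in sub_sigma_events by blast
    have "(\<Union>s\<in>?P. ?C s \<inter> D - ?Z s) \<subseteq> (D - ?D) \<union> (\<Union>s\<in>?P. ?C s \<inter> (k s - ?Z s))"
      by (auto simp: cell_def)
    then have "prob (\<Union>s\<in>?P. ?C s \<inter> D - ?Z s) \<le> prob ((D - ?D) \<union> (\<Union>s\<in>?P. ?C s \<inter> (k s - ?Z s)))"
      by (rule finite_measure_mono)
        (intro sets.Un sets.finite_UN sets.Int sets.Diff De De' Ce ke Ze, simp)
    also have "\<dots> \<le> prob (D - ?D) + prob (\<Union>s\<in>?P. ?C s \<inter> (k s - ?Z s))"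
      by (rule measure_Un_le)
        (intro sets.finite_UN sets.Int sets.Diff De De' Ce ke Ze, simp?)+
    also have "prob (\<Union>s\<in>?P. ?C s \<inter> (k s - ?Z s)) \<le> (\<Sum>s\<in>?P. prob (?C s \<inter> (k s - ?Z s)))"
      using Ce ke Ze by (intro finite_measure_subadditive_finite) auto
    also have "\<dots> \<le> (\<Sum>s\<in>?P. prob ((?C s - D) \<inter> k s) / \<delta>)"
      using Ce De k(1) by (intro sum_mono prob_outside_density_set[OF K _ _ _ \<delta>]) auto
    also have "\<dots> = (\<Sum>s\<in>?P. prob ((?C s - D) \<inter> k s)) / \<delta>"
      by (simp add: sum_divide_distrib)
    \<comment> \<open>The cells are disjoint, so the local excesses
      \<open>(?C s - D) \<inter> k s\<close> add up to the single approximation error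
      \<open>?D - D\<close>, regardless of the number of cells.\<close>
    also have "(\<Sum>s\<in>?P. prob ((?C s - D) \<inter> k s)) = prob (\<Union>s\<in>?P. (?C s - D) \<inter> k s)"
      using Ce De ke by (intro finite_measure_finite_Union[symmetric])
        (auto simp: disjoint_family_on_def cell_def)
    also have "\<dots> \<le> prob (sym_diff D ?D)"
      using De De' by (intro finite_measure_mono) (auto simp: cell_def)
    also have "prob (D - ?D) \<le> prob (sym_diff D ?D)"
      using De De' by (intro finite_measure_mono) auto
    finally have "prob (\<Union>s\<in>?P. ?C s \<inter> D - ?Z s) \<le> prob (sym_diff D ?D) + prob (sym_diff D ?D) / \<delta>"
      using \<delta> by (simp add: divide_right_mono)
    also have "\<dots> \<le> \<theta> + \<theta> / \<delta>"
      using k(2) \<delta> by (intro add_mono divide_right_mono) auto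
    finally show "prob (\<Union>s\<in>?P. ?C s \<inter> D - ?Z s) \<le> \<eta>"
      using \<theta>(2) by simp
  qed
qed

text \<open>The density bound is known given \<open>K\<close>, whereas \<open>S\<close> lies only in
  the larger \<open>H\<close>. By \<open>rel_indep_integral_cprob_over\<close>, integrating
  \<open>P(C | K)\<close> and \<open>P(C - D | K)\<close> over such an \<open>S\<close> still yields
  the true probabilities.\<close>

lemma prob_subset_density_set:
  assumes sub: "sub_sigma B1" "sub_sigma H" "sub_sigma L" "sub_sigma K"
    and LK: "L \<subseteq> K" and KH: "K \<subseteq> H"
    and ri: "rel_indep M B1 H L"
    and C: "C \<in> B1" and D: "D \<in> sigma_sets (space M) (B1 \<union> K)" and S: "S \<in> H"
    and \<delta>: "\<delta> > 0" and dens: "S \<subseteq> density_set K \<delta> C D"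
  shows "prob ((C - D) \<inter> S) \<le> \<delta> * prob (C \<inter> S)"
    and "prob S > 0 \<Longrightarrow> prob (C \<inter> S) > 0"
proof -
  have BK: "sub_sigma (sigma_sets (space M) (B1 \<union> K))"
    using sub by (intro sub_sigma_sigma_sets) (auto simp: sub_sigma_def)
  have C': "C \<in> sigma_sets (space M) (B1 \<union> K)"
    using C by auto
  have CD: "C - D \<in> sigma_sets (space M) (B1 \<union> K)"
    using C' D sets.Diff BK by (metis sets_sigma_sub_sigma)
  have ev: "C \<in> events" "C - D \<in> events" "S \<in> events"
    using C' CD BK S sub(2) sub_sigma_events by blast+
  note eq = rel_indep_integral_cprob_over[OF sub LK KH ri _ S]
  have "prob ((C - D) \<inter> S) = (\<integral>x. indicator S x * cprob K (C - D) x \<partial>M)"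
    using eq[OF CD] by simp
  also have "\<dots> \<le> (\<integral>x. indicator S x * (\<delta> * cprob K C x) \<partial>M)"
    using ev sub(4) dens
    by (intro integral_indicator_mono integrable_mult_right cprob_integrable)
      (auto simp: density_set_def intro: less_imp_le)
  also have "\<dots> = \<delta> * (\<integral>x. indicator S x * cprob K C x \<partial>M)"
    by (simp add: mult.left_commute flip: integral_mult_right_zero)
  also have "\<dots> = \<delta> * prob (C \<inter> S)"
    using eq[OF C'] by simp
  finally show "prob ((C - D) \<inter> S) \<le> \<delta> * prob (C \<inter> S)" .
  show "prob (C \<inter> S) > 0" if "prob S > 0"
  proof (rule ccontr)
    assume "\<not> prob (C \<inter> S) > 0"
    then have "(\<integral>x. indicator S x * cprob K C x \<partial>M) = 0"
      using eq[OF C'] measure_nonneg[of M "C \<inter> S"] by linarith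
    moreover have "integrable M (\<lambda>x. indicator S x * cprob K C x)"
      using integrable_mult_indicator[OF ev(3) cprob_integrable[OF sub(4) ev(1)]] by simp
    moreover have "AE x in M. 0 \<le> indicator S x * cprob K C x"
      using AE_cprob_bounds[OF sub(4) ev(1)] by eventually_elim auto
    \<comment> \<open>Now \<open>P(C | K)\<close> vanishes almost everywhere on \<open>S\<close>,
      which contradicts the strict inequality defining the density set unless \<open>S\<close> is
      null.\<close>
    ultimately have "AE x in M. indicator S x * cprob K C x = 0"
      using integral_nonneg_eq_0_iff_AE by blast
    then have "AE x in M. x \<notin> S"
      using AE_cprob_bounds[OF sub(4) ev(2)]
    proof eventually_elim
      case (elim x)
      then show ?case
        using dens \<delta> by (auto simp: density_set_def indicator_def)
    qed
    then have "prob S = 0"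
      using ev(3) by (simp add: AE_iff_null_sets null_setsD1 measure_def)
    then show False
      using that by simp
  qed
qed

end

section \<open>Joins of sigma-algebras and finite intersections\<close>

lemma sigma_join_mono: "A \<subseteq> A' \<Longrightarrow> sigma_join \<Omega> B A \<subseteq> sigma_join \<Omega> B A'"
  unfolding sigma_join_def by (rule sigma_sets_mono') auto

lemma sigma_join_upper: "i \<in> A \<Longrightarrow> B i \<subseteq> sigma_join \<Omega> B A"
  unfolding sigma_join_def by auto

lemma sigma_sets_Un_sigma_sets:
  "sigma_sets \<Omega> (G \<union> sigma_sets \<Omega> A) = sigma_sets \<Omega> (G \<union> A)"
proof (rule sigma_sets_eqI)
  fix a assume "a \<in> G \<union> sigma_sets \<Omega> A"
  then show "a \<in> sigma_sets \<Omega> (G \<union> A)"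
    using sigma_sets_mono'[of A "G \<union> A" \<Omega>] by auto
qed auto

lemma sigma_join_insert:
  "sigma_join \<Omega> B (insert i A) = sigma_sets \<Omega> (B i \<union> sigma_join \<Omega> B A)"
  unfolding sigma_join_def sigma_sets_Un_sigma_sets by simp

text \<open>Under nesting, this collapses the join over all faces of \<open>e\<close> to
  \<open>B e\<close>, so the relaxed measurability of the induction ends at the required
  one.\<close>

lemma sigma_join_least:
  assumes "i \<in> A" "\<And>j. j \<in> A \<Longrightarrow> B j \<subseteq> B i" "sigma_algebra \<Omega> (B i)"
  shows "sigma_join \<Omega> B A = B i"
proof -
  have "(\<Union>j\<in>A. B j) = B i"
    using assms by blast
  then show ?thesis
    using assms(3) by (simp add: sigma_join_def sigma_algebra.sigma_sets_eq)
qed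

context prob_space
begin

lemma sub_sigma_join: "(\<And>i. i \<in> A \<Longrightarrow> sub_sigma (B i)) \<Longrightarrow> sub_sigma (sigma_join (space M) B A)"
  unfolding sigma_join_def by (rule sub_sigma_sigma_sets) (auto dest: sub_sigma_events)

lemma event_Inter_in:
  assumes "sub_sigma K" "finite A" "\<And>i. i \<in> A \<Longrightarrow> E i \<in> K"
  shows "event_Inter (space M) E A \<in> K"
proof -
  interpret sigma_algebra "space M" K
    using assms(1) by (simp add: sub_sigma_def)
  show ?thesis
  proof (cases "A = {}")
    case False
    then have "(\<Inter>i\<in>A. E i) \<in> K"
      using assms by (intro finite_INT) auto
    then show ?thesis
      by (auto simp: event_Inter_def)
  qed (simp add: event_Inter_def)
qed

section \<open>The induction on downsets\<close>

text \<open>Each \<open>e\<close> in \<open>Imax\<close> keeps its event after leaving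
  \<open>I\<close>; only the sigma-algebra allowed for \<open>D e\<close> shrinks. The conclusion is
  an implication because the induction hypothesis is applied on every cell before anything is known
  about the measure of the intersection there.\<close>

lemma regular_removal:
  fixes Imax I :: "'j set set" and B :: "'j set \<Rightarrow> 'a set set" and D :: "'j set \<Rightarrow> 'a set"
  assumes Breg: "algebra (space M) Breg" "Breg \<subseteq> events"
    and fin: "finite Imax"
    and sub: "\<And>e. e \<in> Imax \<Longrightarrow> sub_sigma (B e)"
    and gen: "\<And>e. e \<in> Imax \<Longrightarrow> \<exists>G :: nat \<Rightarrow> 'a set. range G \<subseteq> Breg \<and> B e = sigma_sets (space M) (range G)"
    and indep: "\<And>e A. e \<in> Imax \<Longrightarrow> A \<subseteq> Imax \<Longrightarrow>
      rel_indep M (B e) (sigma_join (space M) B A) (sigma_join (space M) (\<lambda>f. B (e \<inter> f)) A)"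
    and I: "I \<subseteq> Imax" "\<And>e e'. e \<in> I \<Longrightarrow> e' \<subseteq> e \<Longrightarrow> e' \<in> I"
    and D: "\<And>e. e \<in> Imax \<Longrightarrow> D e \<in> sigma_join (space M) B {f \<in> I. f \<subseteq> e}"
    and \<epsilon>: "\<epsilon> > 0"
  shows "\<exists>F. (\<forall>e\<in>Imax. F e \<in> sigma_join (space M) B {f \<in> I. f \<subseteq> e} \<inter> Breg \<and> prob (D e - F e) \<le> \<epsilon>) \<and>
    (event_Inter (space M) F Imax \<noteq> {} \<longrightarrow> prob (event_Inter (space M) D Imax) > 0)"
proof -
  interpret Breg: algebra "space M" Breg
    by (rule Breg(1))
  have "finite I"
    using I(1) fin by (rule finite_subset)
  then show ?thesis
    using I D \<epsilon>
  proof (induction I arbitrary: D \<epsilon> rule: finite_psubset_induct)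
    case (psubset I D \<epsilon>)
    note I = psubset.prems(1,2) and D = psubset.prems(3) and \<epsilon> = psubset.prems(4)
    show ?case
    proof (cases "I = {}")
      case True
      \<comment> \<open>All joins are now trivial, so every \<open>D e\<close> is regular and
        \<open>F = D\<close> works without error.\<close>
      then have D01: "D e = {} \<or> D e = space M" if "e \<in> Imax" for e
        using D[OF that] by (auto simp: sigma_join_def sigma_sets_empty_eq)
      have "prob (event_Inter (space M) D Imax) > 0" if "event_Inter (space M) D Imax \<noteq> {}"
      proof -
        have "event_Inter (space M) D Imax = space M"
          using that D01 by (fastforce simp: event_Inter_def)
        then show ?thesis
          by (simp add: prob_space)
      qed
      moreover have "D e \<in> Breg" if "e \<in> Imax" for e
        using D01[OF that] by auto
      ultimately show ?thesis
        using D \<epsilon> by (intro exI[of _ D]) auto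
    next
      case False
      \<comment> \<open>Maximality of \<open>g\<close> ensures that \<open>I - {g}\<close> is again
        closed under subsets.\<close>
      then obtain g where g: "g \<in> I" "\<And>f. f \<in> I \<Longrightarrow> g \<subseteq> f \<Longrightarrow> g = f"
        using finite_has_maximal[OF psubset.hyps(1)] by blast
      define I' where "I' = I - {g}"
      define N where "N = {e \<in> Imax. g \<subseteq> e}"
      \<comment> \<open>A union bound over \<open>N\<close> will then lose at most half of the
        measure.\<close>
      define \<delta> where "\<delta> = 1 / (2 * real (card N))"
      define H where "H = sigma_join (space M) B I'"
      define K where "K = (\<lambda>e. sigma_join (space M) B {f \<in> I'. f \<subseteq> e})"
      define L where "L = sigma_join (space M) (\<lambda>f. B (g \<inter> f)) I'"
      have gI: "g \<in> Imax" and I'I: "I' \<subseteq> Imax" "I' \<subset> I"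
        using g I by (auto simp: I'_def)
      have I'_down: "e' \<in> I'" if "e \<in> I'" "e' \<subseteq> e" for e e'
        using that g I unfolding I'_def by blast
      have N: "finite N" "g \<in> N"
        using fin gI by (auto simp: N_def)
      then have \<delta>: "\<delta> > 0" "card N * \<delta> = 1 / 2"
        by (auto simp: \<delta>_def card_gt_0_iff)
      have gf: "g \<inter> f \<in> I'" if "f \<in> I'" for f
        by (rule I'_down[OF that]) simp
      have sH: "sub_sigma H" and sK: "sub_sigma (K e)" and sL: "sub_sigma L" for e
        using I'I gf unfolding H_def K_def L_def by (auto intro!: sub_sigma_join sub)
      have KH: "K e \<subseteq> H" for e
        unfolding K_def H_def by (rule sigma_join_mono) auto
      have LK: "L \<subseteq> K e" if "g \<subseteq> e" for e
      proof -
        \<comment> \<open>Each \<open>g \<inter> f\<close> is in \<open>I'\<close> and below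
          \<open>e\<close>, so the conditioning sigma-algebra supplied by independence is contained
          in \<open>K e\<close>.\<close>
        have "(\<Union>f\<in>I'. B (g \<inter> f)) \<subseteq> (\<Union>f\<in>{f \<in> I'. f \<subseteq> e}. B f)"
          using gf that by blast
        then show ?thesis
          unfolding L_def K_def sigma_join_def by (rule sigma_sets_mono')
      qed
      have ri: "rel_indep M (B g) H L"
        unfolding H_def L_def by (rule indep[OF gI I'I(1)])
      obtain G :: "nat \<Rightarrow> 'a set" where G: "range G \<subseteq> Breg" "B g = sigma_sets (space M) (range G)"
        using gen[OF gI] by blast
      have Ge: "range G \<subseteq> events" and GB: "range G \<subseteq> B g"
        using G Breg by auto
      have join_N: "sigma_join (space M) B {f \<in> I. f \<subseteq> e} = sigma_sets (space M) (B g \<union> K e)"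
        if "g \<subseteq> e" for e
      proof -
        have "{f \<in> I. f \<subseteq> e} = insert g {f \<in> I'. f \<subseteq> e}"
          using that g(1) by (auto simp: I'_def)
        then show ?thesis
          by (simp add: sigma_join_insert K_def)
      qed
      have join_G: "sigma_sets (space M) (B g \<union> K e) = sigma_sets (space M) (range G \<union> K e)" for e
        unfolding G(2) by (simp add: Un_commute[of _ "K e"] sigma_sets_Un_sigma_sets)
      have join_not_N: "sigma_join (space M) B {f \<in> I. f \<subseteq> e} = K e" if "\<not> g \<subseteq> e" for e
      proof -
        have "{f \<in> I. f \<subseteq> e} = {f \<in> I'. f \<subseteq> e}"
          using that by (auto simp: I'_def)
        then show ?thesis
          by (simp add: K_def)
      qed
      have K_join: "K e \<subseteq> sigma_join (space M) B {f \<in> I. f \<subseteq> e}" for e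
        unfolding K_def by (rule sigma_join_mono) (auto simp: I'_def)
      have s_join: "sub_sigma (sigma_join (space M) B {f \<in> I. f \<subseteq> e})" for e
        using I(1) by (intro sub_sigma_join sub) auto
      have De: "D e \<in> events" if "e \<in> Imax" for e
        using D[OF that] s_join sub_sigma_events by blast
      have "\<forall>e\<in>N. \<exists>n. \<forall>m\<ge>n. prob (\<Union>s\<in>Pow {..<m}. cell (space M) G m s \<inter> D e
          - density_set (K e) \<delta> (cell (space M) G m s) (D e)) \<le> \<epsilon> / 2"
        using D join_N join_G Ge sK \<delta> \<epsilon>
        by (intro ballI prob_cells_outside_density_sets) (auto simp: N_def)
      from bchoice[OF this] obtain n where n: "\<forall>e\<in>N. \<forall>m\<ge>n e. prob (\<Union>s\<in>Pow {..<m}.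
          cell (space M) G m s \<inter> D e - density_set (K e) \<delta> (cell (space M) G m s) (D e)) \<le> \<epsilon> / 2" ..
      \<comment> \<open>One partition fine enough for all \<open>e\<close> in \<open>N\<close> at
        once.\<close>
      define m where "m = (\<Sum>e\<in>N. n e)"
      have nm: "n e \<le> m" if "e \<in> N" for e
        unfolding m_def using N(1) that by (intro member_le_sum) auto
      define P where "P = Pow {..<m}"
      have P: "finite P" "P \<noteq> {}" "card P > 0"
        by (auto simp: P_def card_gt_0_iff)
      define C where "C = cell (space M) G m"
      have Creg: "C s \<in> Breg" and CB: "C s \<in> B g" for s
        using cell_in_algebra[OF Breg(1) G(1)] cell_in_algebra[OF sub_sigma_algebra[OF sub[OF gI]] GB]
        by (auto simp: C_def)
      have Ce: "C s \<in> events" for s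
        using Creg Breg by blast
      \<comment> \<open>If \<open>e\<close> does not contain \<open>g\<close>, then
        \<open>D e\<close> already lies in \<open>K e\<close> and is kept unchanged on every
        cell.\<close>
      define D' where "D' = (\<lambda>s e. if g \<subseteq> e then density_set (K e) \<delta> (C s) (D e) else D e)"
      have D'K: "D' s e \<in> K e" if "e \<in> Imax" for s e
        using D[OF that] join_not_N density_set_in[OF sK] by (auto simp: D'_def)
      \<comment> \<open>Half of \<open>\<epsilon>\<close> is split among the cells for the inductive
        choices; the other half pays for passing to density sets.\<close>
      define \<theta> where "\<theta> = \<epsilon> / (2 * real (card P))"
      have \<theta>: "\<theta> > 0" "card P * \<theta> = \<epsilon> / 2"
        using P(3) \<epsilon> by (auto simp: \<theta>_def)
      have "\<forall>s. \<exists>F. (\<forall>e\<in>Imax. F e \<in> K e \<inter> Breg \<and> prob (D' s e - F e) \<le> \<theta>) \<and>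
          (event_Inter (space M) F Imax \<noteq> {} \<longrightarrow> prob (event_Inter (space M) (D' s) Imax) > 0)"
        using D'K unfolding K_def
        by (intro allI psubset.IH[OF I'I(2) I'I(1) I'_down _ \<theta>(1)])
      from choice[OF this] obtain F' where F'': "\<forall>s. (\<forall>e\<in>Imax. F' s e \<in> K e \<inter> Breg \<and> prob (D' s e - F' s e) \<le> \<theta>) \<and>
          (event_Inter (space M) (F' s) Imax \<noteq> {} \<longrightarrow> prob (event_Inter (space M) (D' s) Imax) > 0)" ..
      then have F': "\<And>s e. e \<in> Imax \<Longrightarrow> F' s e \<in> K e" "\<And>s e. e \<in> Imax \<Longrightarrow> F' s e \<in> Breg"
        "\<And>s e. e \<in> Imax \<Longrightarrow> prob (D' s e - F' s e) \<le> \<theta>"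
        "\<And>s. event_Inter (space M) (F' s) Imax \<noteq> {} \<Longrightarrow> prob (event_Inter (space M) (D' s) Imax) > 0"
        by blast+
      have D'e: "D' s e \<in> events" and F'e: "F' s e \<in> events" if "e \<in> Imax" for s e
        using sub_sigma_events[OF sK] D'K F'(1) that by blast+
      \<comment> \<open>For \<open>e\<close> containing \<open>g\<close> the cells are available and
        the inductive choices can be glued. Otherwise one set must serve all cells, hence the
        intersection; its error stays small since \<open>D' s e = D e\<close> for every
        \<open>s\<close>.\<close>
      define F where "F = (\<lambda>e. if g \<subseteq> e then \<Union>s\<in>P. C s \<inter> F' s e else \<Inter>s\<in>P. F' s e)"
      have FA: "F e \<in> A" if "algebra (space M) A" "\<And>s. F' s e \<in> A" "g \<subseteq> e \<Longrightarrow> range C \<subseteq> A" for A e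
      proof -
        interpret A: algebra "space M" A by fact
        show ?thesis
          using that(2,3) P unfolding F_def
          by (auto intro!: A.finite_UN A.Int A.finite_INT)
      qed
      have Fjoin: "F e \<in> sigma_join (space M) B {f \<in> I. f \<subseteq> e}" if "e \<in> Imax" for e
      proof (rule FA)
        show "algebra (space M) (sigma_join (space M) B {f \<in> I. f \<subseteq> e})"
          by (rule sub_sigma_algebra[OF s_join])
        show "F' s e \<in> sigma_join (space M) B {f \<in> I. f \<subseteq> e}" for s
          using F'(1)[OF that] K_join by blast
        show "range C \<subseteq> sigma_join (space M) B {f \<in> I. f \<subseteq> e}" if "g \<subseteq> e"
          using CB sigma_join_upper[of g "{f \<in> I. f \<subseteq> e}" B "space M"] g(1) that by auto
      qed
      have Freg: "F e \<in> Breg" if "e \<in> Imax" for e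
        using FA[OF Breg(1)] F'(2)[OF that] Creg by blast
      have err: "prob (D e - F e) \<le> \<epsilon>" if e: "e \<in> Imax" for e
      proof -
        let ?R = "\<Union>s\<in>P. D' s e - F' s e"
        have Re: "?R \<in> events"
          using D'e[OF e] F'e[OF e] P(1) by (intro sets.finite_UN sets.Diff)
        have "prob ?R \<le> (\<Sum>s\<in>P. prob (D' s e - F' s e))"
          using D'e[OF e] F'e[OF e] P(1) by (intro finite_measure_subadditive_finite) auto
        also have "\<dots> \<le> (\<Sum>s\<in>P. \<theta>)"
          using F'(3)[OF e] by (rule sum_mono)
        finally have R: "prob ?R \<le> \<epsilon> / 2"
          using \<theta>(2) by simp
        show ?thesis
        proof (cases "g \<subseteq> e")
          case True
          let ?Q = "\<Union>s\<in>P. C s \<inter> D e - D' s e"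
          have Qe: "?Q \<in> events"
            using Ce De[OF e] D'e[OF e] P(1) by (intro sets.finite_UN sets.Diff sets.Int)
          have Q: "prob ?Q \<le> \<epsilon> / 2"
            using n[rule_format, OF _ nm, of e] True e by (simp add: N_def P_def C_def D'_def)
          have "D e - F e \<subseteq> ?Q \<union> ?R"
          proof
            fix x assume x: "x \<in> D e - F e"
            then have "x \<in> C (cell_index G m x)" "cell_index G m x \<in> P"
              using sets.sets_into_space[OF De[OF e]] cell_index_subset[of G m x]
              by (auto simp: C_def cell_def P_def)
            then show "x \<in> ?Q \<union> ?R"
              using x True unfolding F_def by auto
          qed
          then have "prob (D e - F e) \<le> prob (?Q \<union> ?R)"
            using Qe Re by (intro finite_measure_mono sets.Un)
          also have "\<dots> \<le> prob ?Q + prob ?R"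
            using Qe Re by (rule measure_Un_le)
          finally show ?thesis
            using Q R by simp
        next
          case False
          then have "D e - F e \<subseteq> ?R"
            by (auto simp: F_def D'_def)
          then have "prob (D e - F e) \<le> prob ?R"
            using Re by (rule finite_measure_mono)
          then show ?thesis
            using R \<epsilon> by simp
        qed
      qed
      have pos: "prob (event_Inter (space M) D Imax) > 0" if ne: "event_Inter (space M) F Imax \<noteq> {}"
      proof -
        obtain x where x: "x \<in> space M" "\<And>e. e \<in> Imax \<Longrightarrow> x \<in> F e"
          using ne by (auto simp: event_Inter_def)
        \<comment> \<open>The cell of \<open>x\<close> selects the single instance of the induction
          hypothesis that is needed: \<open>x\<close> lies in \<open>F' s e\<close> for every
          \<open>e\<close>.\<close>
        define s where "s = cell_index G m x"
        have s: "s \<in> P"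
          using cell_index_subset by (simp add: s_def P_def)
        have "x \<in> F' s e" if "e \<in> Imax" for e
          using x(2)[OF that] s by (auto simp: F_def C_def cell_def s_def split: if_splits)
        then have "event_Inter (space M) (F' s) Imax \<noteq> {}"
          using x(1) by (auto simp: event_Inter_def)
        then have S_pos: "prob (event_Inter (space M) (D' s) Imax) > 0"
          by (rule F'(4))
        let ?S = "event_Inter (space M) (D' s) Imax" and ?D = "event_Inter (space M) D Imax"
        \<comment> \<open>The sets \<open>D' s e\<close> belong to different \<open>K e\<close>, and
          their intersection is placed in the common \<open>H\<close>; this is why densities must be
          transferred from \<open>K e\<close> to \<open>H\<close>.\<close>
        have SH: "?S \<in> H"
          using sH fin by (rule event_Inter_in) (use D'K KH in blast)
        have Se: "?S \<in> events"
          using sH SH by (rule sub_sigma_events)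
        have DIe: "?D \<in> events"
          using fin De by (intro event_Inter_in) (auto simp: sub_sigma_def sets.sigma_algebra_axioms)
        have dens: "?S \<subseteq> density_set (K e) \<delta> (C s) (D e)" if "e \<in> N" for e
          using that by (auto simp: event_Inter_def D'_def N_def split: if_splits)
        have DB: "D e \<in> sigma_sets (space M) (B g \<union> K e)" if "e \<in> N" for e
          using D join_N that by (auto simp: N_def)
        have LKN: "L \<subseteq> K e" if "e \<in> N" for e
          using LK that by (simp add: N_def)
        note psd = prob_subset_density_set[OF sub[OF gI] sH sL sK LKN KH ri CB DB SH \<delta>(1) dens]
        have CS_pos: "prob (C s \<inter> ?S) > 0"
          using psd(2)[OF N(2) N(2) N(2)] S_pos by blast
        have CSe: "(C s - D e) \<inter> ?S \<in> events" if "e \<in> N" for e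
          using Ce De Se that by (auto simp: N_def)
        \<comment> \<open>Leaving \<open>?D\<close> inside \<open>?S\<close> is possible only
          through some \<open>e\<close> in \<open>N\<close>, because \<open>D' s e = D e\<close> for
          all other \<open>e\<close>.\<close>
        have "C s \<inter> ?S \<subseteq> ?D \<union> (\<Union>e\<in>N. (C s - D e) \<inter> ?S)"
        proof
          fix y assume y: "y \<in> C s \<inter> ?S"
          show "y \<in> ?D \<union> (\<Union>e\<in>N. (C s - D e) \<inter> ?S)"
          proof (cases "\<forall>e\<in>N. y \<in> D e")
            case True
            have "y \<in> D e" if "e \<in> Imax" for e
            proof (cases "g \<subseteq> e")
              case g_le: True
              then show ?thesis
                using True that by (simp add: N_def)
            next
              case False
              have "y \<in> D' s e"
                using y that by (simp add: event_Inter_def)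
              then show ?thesis
                using False by (simp add: D'_def)
            qed
            then show ?thesis
              using y by (simp add: event_Inter_def)
          next
            case False
            then show ?thesis
              using y by blast
          qed
        qed
        then have "prob (C s \<inter> ?S) \<le> prob (?D \<union> (\<Union>e\<in>N. (C s - D e) \<inter> ?S))"
          using DIe CSe N(1) by (intro finite_measure_mono sets.Un sets.finite_UN)
        also have "\<dots> \<le> prob ?D + prob (\<Union>e\<in>N. (C s - D e) \<inter> ?S)"
          using DIe CSe N(1) by (intro measure_Un_le sets.finite_UN)
        also have "prob (\<Union>e\<in>N. (C s - D e) \<inter> ?S) \<le> (\<Sum>e\<in>N. prob ((C s - D e) \<inter> ?S))"
          using CSe N(1) by (intro finite_measure_subadditive_finite) auto
        also have "\<dots> \<le> (\<Sum>e\<in>N. \<delta> * prob (C s \<inter> ?S))"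
          using psd(1) by (intro sum_mono)
        also have "\<dots> = prob (C s \<inter> ?S) / 2"
          using \<delta>(2) by (simp flip: mult.assoc)
        finally show ?thesis
          using CS_pos by simp
      qed
      show ?thesis
        using Fjoin Freg err pos by (intro exI[of _ F]) blast
    qed
  qed
qed

end

section \<open>Reduction of the theorem to the induction\<close>

theorem theorem4p2:
  fixes M :: "'a measure"
    and Breg :: "'a set set"
    and J :: "'j set"
    and Imax :: "'j set set"
    and B :: "'j set \<Rightarrow> 'a set set"
    and E :: "'j set \<Rightarrow> 'a set"
    and \<epsilon> :: real
  assumes "prob_space M"
    and "countably_generated (space M) (sets M)"
    and "algebra (space M) Breg" and "Breg \<subseteq> sets M"
    and "finite J" and "downset J Imax"
    and "\<And>e. e \<in> Imax \<Longrightarrow> factor M (B e)"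
    and regularisability: "\<And>e. e \<in> Imax \<Longrightarrow>
      \<exists>G. countable G \<and> G \<subseteq> Breg \<and> B e = sigma_sets (space M) G"
    and nesting: "\<And>e e'. e \<in> Imax \<Longrightarrow> e' \<in> Imax \<Longrightarrow> e \<subseteq> e' \<Longrightarrow> B e \<subseteq> B e'"
    and independence: "\<And>e (l :: nat) es. e \<in> Imax \<Longrightarrow> (\<And>i. i \<in> {1..l} \<Longrightarrow> es i \<in> Imax) \<Longrightarrow>
      rel_indep M (B e) (sigma_join (space M) (\<lambda>i. B (es i)) {1..l})
        (sigma_join (space M) (\<lambda>i. B (e \<inter> es i)) {1..l})"
    and "\<And>e. e \<in> Imax \<Longrightarrow> E e \<in> B e"
    and "measure M (event_Inter (space M) E Imax) = 0"
    and "\<epsilon> > 0"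
  shows "\<exists>F :: 'j set \<Rightarrow> 'a set.
    (\<forall>e\<in>Imax. F e \<in> B e \<inter> Breg) \<and>
    (\<forall>e\<in>Imax. measure M (E e - F e) \<le> \<epsilon>) \<and>
    event_Inter (space M) F Imax = {}"
proof -
  interpret prob_space M by fact
  interpret Breg: algebra "space M" Breg by fact
  have down: "e' \<in> Imax" if "e \<in> Imax" "e' \<subseteq> e" for e e'
    using \<open>downset J Imax\<close> that unfolding downset_def by blast
  have fin: "finite Imax"
    using \<open>downset J Imax\<close> \<open>finite J\<close> unfolding downset_def by (meson finite_Pow_iff finite_subset)
  have sub: "sub_sigma (B e)" if "e \<in> Imax" for e
    using assms(7)[OF that] by (simp add: factor_def sub_sigma_def)
  have gen: "\<exists>G :: nat \<Rightarrow> 'a set. range G \<subseteq> Breg \<and> B e = sigma_sets (space M) (range G)"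
    if e: "e \<in> Imax" for e
  proof -
    obtain G where G: "countable G" "G \<subseteq> Breg" "B e = sigma_sets (space M) G"
      using regularisability[OF e] by blast
    \<comment> \<open>Adding \<open>{}\<close> leaves the generated sigma-algebra unchanged and
      makes the family nonempty, so that it can be enumerated by \<open>nat\<close>.\<close>
    have "range (from_nat_into (insert {} G)) = insert {} G"
      using G(1) by (intro range_from_nat_into) auto
    moreover have "sigma_sets (space M) (insert {} G) = sigma_sets (space M) G"
      by (rule sigma_sets_eqI) (auto intro: sigma_sets.Empty)
    ultimately show ?thesis
      using G by (intro exI[of _ "from_nat_into (insert {} G)"]) auto
  qed
  \<comment> \<open>Enumerating \<open>A\<close> passes from joins over sequences to joins over
    sets; an empty \<open>A\<close> corresponds to \<open>l = 0\<close>.\<close>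
  have indep: "rel_indep M (B e) (sigma_join (space M) B A) (sigma_join (space M) (\<lambda>f. B (e \<inter> f)) A)"
    if "e \<in> Imax" "A \<subseteq> Imax" for e A
  proof -
    have "finite A"
      using that(2) fin by (rule finite_subset)
    then obtain es :: "nat \<Rightarrow> 'j set" where "bij_betw es {1..card A} A"
      using ex_bij_betw_nat_finite_1 by blast
    then have A: "es ` {1..card A} = A"
      by (simp add: bij_betw_def)
    have join: "sigma_join (space M) (\<lambda>i. b (es i)) {1..card A} = sigma_join (space M) b A" for b
      using A by (simp add: sigma_join_def flip: image_image)
    have "rel_indep M (B e) (sigma_join (space M) (\<lambda>i. B (es i)) {1..card A})
        (sigma_join (space M) (\<lambda>i. B (e \<inter> es i)) {1..card A})"
      using that A by (intro independence) auto
    then show ?thesis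
      using join[of B] join[of "\<lambda>f. B (e \<inter> f)"] by simp
  qed
  have join: "sigma_join (space M) B {f \<in> Imax. f \<subseteq> e} = B e" if "e \<in> Imax" for e
    using that nesting sub by (intro sigma_join_least) (auto simp: sub_sigma_def)
  \<comment> \<open>Take \<open>I = Imax\<close>. As the intersection of the \<open>E e\<close> is
    null, the implication leaves only the empty intersection of the \<open>F e\<close>.\<close>
  have "\<exists>F. (\<forall>e\<in>Imax. F e \<in> sigma_join (space M) B {f \<in> Imax. f \<subseteq> e} \<inter> Breg \<and> prob (E e - F e) \<le> \<epsilon>) \<and>
    (event_Inter (space M) F Imax \<noteq> {} \<longrightarrow> prob (event_Inter (space M) E Imax) > 0)"
    by (rule regular_removal[OF assms(3,4) fin sub gen indep order_refl down _ \<open>\<epsilon> > 0\<close>])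
      (use join assms(11) in auto)
  then show ?thesis
    using join assms(12) by (metis less_irrefl)
qed

end
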